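(* There exists a $\Delta^0_2$ fuzzy set $A$ such that for every $\Delta^0_2$-approximation $f$ of $A$, the sequence $(m^f_\Sigma(0,s))_{s\in\omega}$ does not converge as $s \to \infty$. In particular, $A$ is not fuzzy $n$-c.e. for any $n \geq 1$.
   Context: A fuzzy subset of $\omega$ is a function $A\colon \omega \to [0;1]_{\mathbb{R}}$. $[0;1]_{\mathbb{Q}}$ denotes the rationals in $[0,1]$, coded effectively by natural numbers. A fuzzy set $A$ is $\Delta^0_2$ if there is a computable $f\colon \omega\times\omega\to[0;1]_{\mathbb{Q}}$ with $\lim_s f(x,s) = A(x)$ for all $x$; such an $f$ is called a $\Delta^0_2$-approximation of $A$. For a total $f\colon \omega\times\omega \to [0;1]_{\mathbb{Q}}$, its $\Sigma$-mind change function $m^f_\Sigma\colon \omega\times\omega \to \{-1,1\}$ is defined by: $m^f_\Sigma(x,0) = 1$; if $m^f_\Sigma(x,s)=1$, then $m^f_\Sigma(x,s+1)=1$ when $f(x,s)\leq f(x,s+1)$ and $m^f_\Sigma(x,s+1)=-1$ when $f(x,s) > f(x,s+1)$; if $m^f_\Sigma(x,s)=-1$, then $m^f_\Sigma(x,s+1)=-1$ when $f(x,s)\geq f(x,s+1)$ and $m^f_\Sigma(x,s+1)=1$ when $f(x,s)<f(x,s+1)$. A fuzzy set $A$ is fuzzy $n$-c.e. ($n \geq 1$) if there is a computable $f\colon \omega\times\omega \to [0;1]_{\mathbb{Q}}$ such that for all $x$: $\lim_s f(x,s) = A(x)$, $f(x,0) = 0$, and $|\{s \in \omega : m^f_\Sigma(x,s+1)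 \neq m^f_\Sigma(x,s)\}| \leq n-1$. *)

theory Defs
  imports Complex_Main "HOL-Library.Nat_Bijection" "HOL-Library.Countable"
begin

text \<open>
  Partial recursive functions, presented as unary functions on the natural numbers: a function of
  several arguments receives them packed by \<^const>\<open>prod_encode\<close>. Since \<^const>\<open>prod_encode\<close> and its
  projections are primitive recursive, this yields the usual class. The identity is
  \<open>PairP FstP SndP\<close>; \<open>RecP p q\<close> is primitive recursion with parameter; \<open>MuP p\<close> is unbounded
  search, undefined if some value of \<open>p\<close> before the first zero is undefined.
\<close>

datatype prog =
    ZeroP
  | SuccP
  | FstP
  | SndP
  | PairP prog prog
  | CompP prog prog
  | RecP prog prog
  | MuP prog

inductive computes :: "prog \<Rightarrow> nat \<Rightarrow> nat \<Rightarrow> bool" where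
  zero: "computes ZeroP x 0"
| succ: "computes SuccP x (Suc x)"
| first: "computes FstP (prod_encode (x, y)) x"
| second: "computes SndP (prod_encode (x, y)) y"
| pair: "computes p x u \<Longrightarrow> computes q x v \<Longrightarrow> computes (PairP p q) x (prod_encode (u, v))"
| comp: "computes q x u \<Longrightarrow> computes p u v \<Longrightarrow> computes (CompP p q) x v"
| rec_0: "computes p x u \<Longrightarrow> computes (RecP p q) (prod_encode (x, 0)) u"
| rec_Suc: "computes (RecP p q) (prod_encode (x, n)) u \<Longrightarrow>
    computes q (prod_encode (x, prod_encode (n, u))) v \<Longrightarrow>
    computes (RecP p q) (prod_encode (x, Suc n)) v"
| mu: "computes p (prod_encode (x, n)) 0 \<Longrightarrow>
    (\<forall>m<n. \<exists>v. computes p (prod_encode (x, m)) (Suc v)) \<Longrightarrow>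
    computes (MuP p) x n"

text \<open>
  Rationals are coded through \<^const>\<open>nat_to_rat_surj\<close>, under which a rational has many codes. As
  equality of coded rationals is decidable, a least code can be found effectively, so the choice of
  code is immaterial.
\<close>

definition computable_unit_rat :: "(nat \<Rightarrow> nat \<Rightarrow> rat) \<Rightarrow> bool" where
  "computable_unit_rat f \<longleftrightarrow>
     (\<forall>x s. 0 \<le> f x s \<and> f x s \<le> 1) \<and>
     (\<exists>p. \<forall>x s. \<exists>c. computes p (prod_encode (x, s)) c \<and> nat_to_rat_surj c = f x s)"

definition fuzzy_set :: "(nat \<Rightarrow> real) \<Rightarrow> bool" where
  "fuzzy_set A \<longleftrightarrow> (\<forall>x. 0 \<le> A x \<and> A x \<le> 1)"

definition delta2_approximation :: "(nat \<Rightarrow> nat \<Rightarrow> rat) \<Rightarrow> (nat \<Rightarrow> real) \<Rightarrow> bool" where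
  "delta2_approximation f A \<longleftrightarrow>
     computable_unit_rat f \<and> (\<forall>x. (\<lambda>s. real_of_rat (f x s)) \<longlonglongrightarrow> A x)"

definition delta2_fuzzy_set :: "(nat \<Rightarrow> real) \<Rightarrow> bool" where
  "delta2_fuzzy_set A \<longleftrightarrow> fuzzy_set A \<and> (\<exists>f. delta2_approximation f A)"

primrec sigma_mind_change :: "(nat \<Rightarrow> nat \<Rightarrow> rat) \<Rightarrow> nat \<Rightarrow> nat \<Rightarrow> int" where
  "sigma_mind_change f x 0 = 1"
| "sigma_mind_change f x (Suc s) =
     (if sigma_mind_change f x s = 1
      then (if f x s \<le> f x (Suc s) then 1 else -1)
      else (if f x s \<ge> f x (Suc s) then -1 else 1))"

definition fuzzy_n_ce :: "nat \<Rightarrow> (nat \<Rightarrow> real) \<Rightarrow> bool" where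
  "fuzzy_n_ce n A \<longleftrightarrow> fuzzy_set A \<and>
     (\<exists>f. computable_unit_rat f \<and>
       (\<forall>x. (\<lambda>s. real_of_rat (f x s)) \<longlonglongrightarrow> A x \<and>
            f x 0 = 0 \<and>
            finite {s. sigma_mind_change f x (Suc s) \<noteq> sigma_mind_change f x s} \<and>
            card {s. sigma_mind_change f x (Suc s) \<noteq> sigma_mind_change f x s} \<le> n - 1))"

end

theory Submission
  imports Defs
begin

text \<open>
  If the mind changes of an approximation settle down, the approximation of \<open>A 0\<close> is eventually
  monotone, and a monotone computable sequence of rationals makes one of the two cuts of its limit
  semidecidable: a rational lies below the limit of a nondecreasing sequence iff it lies below some
  term. So it suffices to build a limit computable real \<open>\<alpha>\<close> with neither cut semidecidable. Write
  \<open>\<alpha>\<close> in base 4 with digits 0 and 3, so that the midpoint \<open>m\<close> of the interval determined by the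
  first \<open>e\<close> digits lies below \<open>\<alpha>\<close> iff the next digit is 3. Whether a program \<open>p\<close> halts on \<open>m\<close>
  decides that digit, at one position \<open>e\<close> so that \<open>p\<close> errs about the left cut, at another so that
  it errs about the right cut. Bounding the running time by \<open>s\<close> yields approximations all of whose
  digits eventually settle.
\<close>

section \<open>Total recursive functions\<close>

abbreviation pair :: "nat \<Rightarrow> nat \<Rightarrow> nat" where
  "pair x y \<equiv> prod_encode (x, y)"

abbreviation pfst :: "nat \<Rightarrow> nat" where
  "pfst z \<equiv> fst (prod_decode z)"

abbreviation psnd :: "nat \<Rightarrow> nat" where
  "psnd z \<equiv> snd (prod_decode z)"

lemma pair_exhaust:
  obtains x y where "z = pair x y"
  by (metis prod.collapse prod_decode_inverse)

lemma computes_FstP: "computes FstP z (pfst z)"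
  by (cases z rule: pair_exhaust) (simp add: computes.first)

lemma computes_SndP: "computes SndP z (psnd z)"
  by (cases z rule: pair_exhaust) (simp add: computes.second)

lemma computes_deterministic: "computes p x y \<Longrightarrow> computes p x z \<Longrightarrow> y = z"
proof (induction arbitrary: z rule: computes.induct)
  case (pair p x u q v)
  from pair.prems show ?case by cases (simp add: pair.IH)
next
  case (comp q x u p v)
  from comp.prems show ?case by cases (use comp.IH in blast)
next
  case (rec_0 p x u q)
  from rec_0.prems show ?case by cases (simp_all add: rec_0.IH)
next
  case (rec_Suc p q x n u v)
  from rec_Suc.prems show ?case by cases (use rec_Suc.IH in auto)
next
  case (mu p x n)
  from mu.prems obtain "computes p (pair x z) 0"
    and before_z: "\<And>m. m < z \<Longrightarrow> \<exists>v. computes p (pair x m) (Suc v)"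
    by cases auto
  with mu.IH have "\<not> z < n" by fastforce
  moreover have "\<not> n < z" using mu.IH(1) before_z by fastforce
  ultimately show ?case by simp
qed (erule computes.cases; simp)+

definition computable_fun :: "(nat \<Rightarrow> nat) \<Rightarrow> bool" where
  "computable_fun f \<longleftrightarrow> (\<exists>p. \<forall>x. computes p x (f x))"

definition computable_pred :: "(nat \<Rightarrow> bool) \<Rightarrow> bool" where
  "computable_pred P \<longleftrightarrow> computable_fun (\<lambda>x. of_bool (P x))"

named_theorems computable_intros

lemma computable_fun_id [computable_intros]: "computable_fun (\<lambda>x. x)"
  unfolding computable_fun_def
  using computes.pair[OF computes_FstP computes_SndP] by (metis prod.collapse prod_decode_inverse)

lemma computable_fun_comp:
  assumes "computable_fun f" "computable_fun g"
  shows "computable_fun (\<lambda>x. f (g x))"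
  using assms unfolding computable_fun_def by (meson computes.comp)

lemma computable_pred_comp:
  assumes "computable_pred P" "computable_fun g"
  shows "computable_pred (\<lambda>x. P (g x))"
  using assms unfolding computable_pred_def by (rule computable_fun_comp)

lemma computable_fun_Suc [computable_intros]:
  assumes "computable_fun f"
  shows "computable_fun (\<lambda>x. Suc (f x))"
proof -
  have "computable_fun Suc"
    unfolding computable_fun_def using computes.succ by blast
  from computable_fun_comp[OF this assms] show ?thesis .
qed

lemma computable_fun_const [computable_intros]: "computable_fun (\<lambda>x. c)"
proof (induction c)
  case 0
  show ?case unfolding computable_fun_def using computes.zero by blast
next
  case (Suc c)
  then show ?case by (rule computable_fun_Suc)
qed

lemma computable_fun_pfst [computable_intros]:
  assumes "computable_fun f"
  shows "computable_fun (\<lambda>x. pfst (f x))"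
  using assms unfolding computable_fun_def by (meson computes.comp computes_FstP)

lemma computable_fun_psnd [computable_intros]:
  assumes "computable_fun f"
  shows "computable_fun (\<lambda>x. psnd (f x))"
  using assms unfolding computable_fun_def by (meson computes.comp computes_SndP)

lemma computable_fun_pair [computable_intros]:
  assumes "computable_fun f" "computable_fun g"
  shows "computable_fun (\<lambda>x. pair (f x) (g x))"
  using assms unfolding computable_fun_def by (meson computes.pair)

lemma computable_fun_rec_nat [computable_intros]:
  assumes "computable_fun a" "computable_fun n"
    and "computable_fun (\<lambda>z. g (pfst z) (pfst (psnd z)) (psnd (psnd z)))"
  shows "computable_fun (\<lambda>x. rec_nat (a x) (\<lambda>k r. g x k r) (n x))"
proof -
  obtain pa pg where computes_pa: "\<And>x. computes pa x (a x)"
    and computes_pg: "\<And>z. computes pg z (g (pfst z) (pfst (psnd z)) (psnd (psnd z)))"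
    using assms unfolding computable_fun_def by blast
  have computes_RecP: "computes (RecP pa pg) (pair x k) (rec_nat (a x) (g x) k)" for x k
  proof (induction k)
    case 0
    show ?case by (simp add: computes.rec_0 computes_pa)
  next
    case (Suc k)
    have "computes pg (pair x (pair k (rec_nat (a x) (g x) k))) (rec_nat (a x) (g x) (Suc k))"
      using computes_pg[of "pair x (pair k (rec_nat (a x) (g x) k))"] by simp
    with Suc show ?case by (rule computes.rec_Suc)
  qed
  have "computes (RecP pa pg) z (rec_nat (a (pfst z)) (g (pfst z)) (psnd z))" for z
    using computes_RecP by (cases z rule: pair_exhaust) simp
  then have "computable_fun (\<lambda>z. rec_nat (a (pfst z)) (g (pfst z)) (psnd z))"
    unfolding computable_fun_def by blast
  from computable_fun_comp[OF this computable_fun_pair[OF computable_fun_id assms(2)]]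
  show ?thesis by simp
qed

lemma computable_fun_of_bool [computable_intros]:
  "computable_pred P \<Longrightarrow> computable_fun (\<lambda>x. of_bool (P x))"
  by (simp add: computable_pred_def)

lemma computable_fun_if [computable_intros]:
  assumes "computable_pred P" "computable_fun f" "computable_fun g"
  shows "computable_fun (\<lambda>x. if P x then f x else g x)"
proof -
  have if_rec: "(if P x then f x else g x) = rec_nat (g x) (\<lambda>_ _. f x) (of_bool (P x))" for x
    by auto
  show ?thesis
    unfolding if_rec by (intro computable_intros assms computable_fun_comp[OF assms(2)])
qed

lemma computable_pred_not [computable_intros]:
  assumes "computable_pred P"
  shows "computable_pred (\<lambda>x. \<not> P x)"
proof -
  have not_if: "of_bool (\<not> P x) = (if P x then 0 else 1 :: nat)" for x by auto
  show ?thesis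
    unfolding computable_pred_def not_if by (intro computable_intros assms)
qed

lemma computable_pred_conj [computable_intros]:
  assumes "computable_pred P" "computable_pred Q"
  shows "computable_pred (\<lambda>x. P x \<and> Q x)"
proof -
  have conj_if: "of_bool (P x \<and> Q x) = (if P x then of_bool (Q x) else 0 :: nat)" for x by auto
  show ?thesis
    unfolding computable_pred_def conj_if by (intro computable_intros assms)
qed

lemma computable_pred_disj [computable_intros]:
  assumes "computable_pred P" "computable_pred Q"
  shows "computable_pred (\<lambda>x. P x \<or> Q x)"
proof -
  have "computable_pred (\<lambda>x. \<not> (\<not> P x \<and> \<not> Q x))" by (intro computable_intros assms)
  then show ?thesis by simp
qed

lemma computable_pred_if [computable_intros]:
  assumes "computable_pred P" "computable_pred Q" "computable_pred R"
  shows "computable_pred (\<lambda>x. if P x then Q x else R x)"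
  unfolding if_bool_eq_disj by (intro computable_intros assms)

lemma computable_pred_iff [computable_intros]:
  assumes "computable_pred P" "computable_pred Q"
  shows "computable_pred (\<lambda>x. P x \<longleftrightarrow> Q x)"
  unfolding iff_conv_conj_imp imp_conv_disj by (intro computable_intros assms)

lemma computable_pred_eq_0 [computable_intros]:
  assumes "computable_fun f"
  shows "computable_pred (\<lambda>x. f x = 0)"
proof -
  have eq_0_rec: "of_bool (n = 0) = (rec_nat 1 (\<lambda>_ _. 0) n :: nat)" for n :: nat
    by (cases n) auto
  show ?thesis
    unfolding computable_pred_def eq_0_rec by (intro computable_intros assms)
qed

lemma computable_fun_diff [computable_intros]:
  assumes "computable_fun f" "computable_fun g"
  shows "computable_fun (\<lambda>x. f x - g x)"
proof -
  have pred_rec: "n - 1 = rec_nat 0 (\<lambda>k _. k) n" for n by (cases n) auto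
  have diff_rec: "m - n = rec_nat m (\<lambda>_ r. rec_nat 0 (\<lambda>k _. k) r) n" for m n
    by (induction n) (simp_all flip: pred_rec)
  show ?thesis unfolding diff_rec by (intro computable_intros assms)
qed

lemma computable_pred_le [computable_intros]:
  assumes "computable_fun f" "computable_fun g"
  shows "computable_pred (\<lambda>x. f x \<le> g x)"
  unfolding diff_is_0_eq[symmetric] by (intro computable_intros assms)

lemma computable_pred_less [computable_intros]:
  assumes "computable_fun f" "computable_fun g"
  shows "computable_pred (\<lambda>x. f x < g x)"
  unfolding Suc_le_eq[symmetric] by (intro computable_intros assms)

lemma computable_pred_eq [computable_intros]:
  assumes "computable_fun f" "computable_fun g"
  shows "computable_pred (\<lambda>x. f x = g x)"
  unfolding eq_iff by (intro computable_intros assms)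

lemma computable_fun_add [computable_intros]:
  assumes "computable_fun f" "computable_fun g"
  shows "computable_fun (\<lambda>x. f x + g x)"
proof -
  have add_rec: "m + n = rec_nat m (\<lambda>_ r. Suc r) n" for m n by (induction n) auto
  show ?thesis unfolding add_rec by (intro computable_intros assms)
qed

lemma computable_fun_mult [computable_intros]:
  assumes "computable_fun f" "computable_fun g"
  shows "computable_fun (\<lambda>x. f x * g x)"
proof -
  have mult_rec: "m * n = rec_nat 0 (\<lambda>_ r. r + m) n" for m n :: nat by (induction n) auto
  show ?thesis
    unfolding mult_rec by (intro computable_intros assms computable_fun_comp[OF assms(1)])
qed

lemma computable_fun_power [computable_intros]:
  assumes "computable_fun f" "computable_fun g"
  shows "computable_fun (\<lambda>x. f x ^ g x)"
proof -
  have power_rec: "m ^ n = rec_nat 1 (\<lambda>_ r. m * r) n" for m n :: nat by (induction n) auto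
  show ?thesis
    unfolding power_rec by (intro computable_intros assms computable_fun_comp[OF assms(1)])
qed

lemma computable_pred_odd [computable_intros]:
  assumes "computable_fun f"
  shows "computable_pred (\<lambda>x. odd (f x))"
proof -
  have odd_rec: "of_bool (odd n) = (rec_nat 0 (\<lambda>_ r. 1 - r) n :: nat)" for n :: nat
    by (induction n) (auto simp flip: of_bool_not_iff)
  show ?thesis
    unfolding computable_pred_def odd_rec by (intro computable_intros assms)
qed

lemma computable_fun_div_2 [computable_intros]:
  assumes "computable_fun f"
  shows "computable_fun (\<lambda>x. f x div 2)"
proof -
  have div_2_rec: "n div 2 = rec_nat 0 (\<lambda>k r. if odd k then Suc r else r) n" for n :: nat
  proof (induction n)
    case (Suc n)
    have "Suc n div 2 = (if odd n then Suc (n div 2) else n div 2)" by auto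
    with Suc show ?case by simp
  qed simp
  show ?thesis unfolding div_2_rec by (intro computable_intros assms)
qed

lemma computable_pred_set_decode [computable_intros]:
  assumes "computable_fun f" "computable_fun g"
  shows "computable_pred (\<lambda>x. f x \<in> set_decode (g x))"
proof -
  have div_power_2_rec: "m div 2 ^ n = rec_nat m (\<lambda>_ r. r div 2) n" for m n :: nat
    by (induction n) (simp_all add: div_mult2_eq power_Suc2 del: power_Suc)
  show ?thesis
    unfolding set_decode_def mem_Collect_eq div_power_2_rec by (intro computable_intros assms)
qed

lemma computable_fun_sum [computable_intros]:
  assumes "computable_fun (\<lambda>z. h (pfst z) (psnd z))" "computable_fun n"
  shows "computable_fun (\<lambda>x. \<Sum>k<n x. h x k)"
proof -
  have sum_rec: "(\<Sum>k<m. h x k) = rec_nat 0 (\<lambda>k r. r + h x k) m" for x m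
    by (induction m) auto
  have "computable_fun (\<lambda>z. pair (pfst z) (pfst (psnd z)))"
    by (intro computable_intros)
  from computable_fun_comp[OF assms(1) this]
  have "computable_fun (\<lambda>z. h (pfst z) (pfst (psnd z)))"
    by simp
  then show ?thesis unfolding sum_rec by (intro computable_intros assms(2))
qed

lemma computable_pred_bex [computable_intros]:
  assumes "computable_pred (\<lambda>z. P (pfst z) (psnd z))" "computable_fun n"
  shows "computable_pred (\<lambda>x. \<exists>k<n x. P x k)"
proof -
  have bex_sum: "(\<exists>k<m. P x k) \<longleftrightarrow> (\<Sum>k<m. of_bool (P x k)) \<noteq> (0 :: nat)" for x m
    by (auto simp: lessThan_def)
  show ?thesis
    unfolding bex_sum by (intro computable_intros assms)
qed

lemma computable_pred_ball [computable_intros]: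
  assumes "computable_pred (\<lambda>z. P (pfst z) (psnd z))" "computable_fun n"
  shows "computable_pred (\<lambda>x. \<forall>k<n x. P x k)"
proof -
  have "computable_pred (\<lambda>x. \<not> (\<exists>k<n x. \<not> P x k))" by (intro computable_intros assms)
  then show ?thesis by simp
qed

lemma computable_fun_set_encode [computable_intros]:
  assumes "computable_pred (\<lambda>z. P (pfst z) (psnd z))" "computable_fun n"
  shows "computable_fun (\<lambda>x. set_encode {k. k < n x \<and> P x k})"
proof -
  have "set_encode {k. k < m \<and> P x k} = (\<Sum>k<m. if P x k then 2 ^ k else 0)" for x m
    unfolding set_encode_def by (simp add: sum.If_cases Int_def conj_commute)
  then show ?thesis by (simp, intro computable_intros assms)
qed

section \<open>Semidecidable predicates and their enumeration\<close>

definition semidecidable :: "(nat \<Rightarrow> bool) \<Rightarrow> bool" where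
  "semidecidable P \<longleftrightarrow> (\<exists>p. \<forall>x. P x \<longleftrightarrow> (\<exists>y. computes p x y))"

lemma semidecidable_ex:
  assumes "computable_pred (\<lambda>z. R (pfst z) (psnd z))"
  shows "semidecidable (\<lambda>x. \<exists>n. R x n)"
proof -
  have "computable_fun (\<lambda>z. of_bool (\<not> R (pfst z) (psnd z)))"
    by (intro computable_intros assms)
  then obtain p where "\<And>z. computes p z (of_bool (\<not> R (pfst z) (psnd z)))"
    unfolding computable_fun_def by blast
  from this[of "pair _ _"] have computes_p: "computes p (pair x n) (of_bool (\<not> R x n))" for x n
    by simp
  have "(\<exists>n. R x n) \<longleftrightarrow> (\<exists>y. computes (MuP p) x y)" for x
  proof
    assume "\<exists>n. R x n"
    then obtain n where "R x n" "\<forall>m<n. \<not> R x m"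
      using exists_least_iff[of "R x"] by blast
    then have "computes p (pair x n) 0" "\<forall>m<n. computes p (pair x m) (Suc 0)"
      using computes_p[of x] by (metis of_bool_eq(1), metis of_bool_eq(2) One_nat_def)
    then show "\<exists>y. computes (MuP p) x y" using computes.mu by blast
  next
    assume "\<exists>y. computes (MuP p) x y"
    then obtain y where "computes p (pair x y) 0" by (auto elim: computes.cases)
    then have "of_bool (\<not> R x y) = (0 :: nat)" using computes_p computes_deterministic by blast
    then show "\<exists>n. R x n" by auto
  qed
  then show ?thesis unfolding semidecidable_def by blast
qed

primrec prog_code :: "prog \<Rightarrow> nat" where
  "prog_code ZeroP = pair 0 0"
| "prog_code SuccP = pair 1 0"
| "prog_code FstP = pair 2 0"
| "prog_code SndP = pair 3 0"
| "prog_code (PairP p q) = pair 4 (pair (prog_code p) (prog_code q))"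
| "prog_code (CompP p q) = pair 5 (pair (prog_code p) (prog_code q))"
| "prog_code (RecP p q) = pair 6 (pair (prog_code p) (prog_code q))"
| "prog_code (MuP p) = pair 7 (pair (prog_code p) 0)"

abbreviation triple :: "nat \<Rightarrow> nat \<Rightarrow> nat \<Rightarrow> nat" where
  "triple a x y \<equiv> pair a (pair x y)"

text \<open>
  One backward application of a rule of \<^const>\<open>computes\<close> to the judgement \<open>triple a x y\<close>, where \<open>D\<close>
  contains the judgements already derived and \<open>n\<close> bounds the search for intermediate values.
\<close>

definition derivable :: "nat \<Rightarrow> nat set \<Rightarrow> nat \<Rightarrow> nat \<Rightarrow> nat \<Rightarrow> bool" where
  "derivable n D a x y \<longleftrightarrow>
     pfst a = 0 \<and> y = 0 \<or>
     pfst a = 1 \<and> y = Suc x \<or>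
     pfst a = 2 \<and> y = pfst x \<or>
     pfst a = 3 \<and> y = psnd x \<or>
     pfst a = 4 \<and> triple (pfst (psnd a)) x (pfst y) \<in> D \<and> triple (psnd (psnd a)) x (psnd y) \<in> D \<or>
     pfst a = 5 \<and> (\<exists>u<n. triple (psnd (psnd a)) x u \<in> D \<and> triple (pfst (psnd a)) u y \<in> D) \<or>
     pfst a = 6 \<and> (if psnd x = 0 then triple (pfst (psnd a)) (pfst x) y \<in> D
       else \<exists>u<n. triple a (pair (pfst x) (psnd x - 1)) u \<in> D \<and>
         triple (psnd (psnd a)) (triple (pfst x) (psnd x - 1) u) y \<in> D) \<or>
     pfst a = 7 \<and> triple (pfst (psnd a)) (pair x y) 0 \<in> D \<and>
       (\<forall>m<y. \<exists>v<n. triple (pfst (psnd a)) (pair x m) (Suc v) \<in> D)"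

lemma derivable_prog_code_iffs:
  "derivable n D (prog_code ZeroP) x y \<longleftrightarrow> y = 0"
  "derivable n D (prog_code SuccP) x y \<longleftrightarrow> y = Suc x"
  "derivable n D (prog_code FstP) x y \<longleftrightarrow> y = pfst x"
  "derivable n D (prog_code SndP) x y \<longleftrightarrow> y = psnd x"
  "derivable n D (prog_code (PairP p q)) x y \<longleftrightarrow>
     triple (prog_code p) x (pfst y) \<in> D \<and> triple (prog_code q) x (psnd y) \<in> D"
  "derivable n D (prog_code (CompP p q)) x y \<longleftrightarrow>
     (\<exists>u<n. triple (prog_code q) x u \<in> D \<and> triple (prog_code p) u y \<in> D)"
  "derivable n D (prog_code (RecP p q)) (pair x 0) y \<longleftrightarrow> triple (prog_code p) x y \<in> D"
  "derivable n D (prog_code (RecP p q)) (pair x (Suc k)) y \<longleftrightarrow>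
     (\<exists>u<n. triple (prog_code (RecP p q)) (pair x k) u \<in> D \<and>
       triple (prog_code q) (triple x k u) y \<in> D)"
  "derivable n D (prog_code (MuP p)) x y \<longleftrightarrow>
     triple (prog_code p) (pair x y) 0 \<in> D \<and>
     (\<forall>m<y. \<exists>v<n. triple (prog_code p) (pair x m) (Suc v) \<in> D)"
  by (simp_all add: derivable_def)

declare prog_code.simps [simp del]

lemma derivable_sound:
  assumes D_sound: "\<And>p x y. triple (prog_code p) x y \<in> D \<Longrightarrow> computes p x y"
    and derivable: "derivable n D (prog_code p) x y"
  shows "computes p x y"
proof (cases p)
  case (PairP q r)
  then have "computes q x (pfst y)" "computes r x (psnd y)"
    using derivable D_sound by (auto simp: derivable_prog_code_iffs)
  then show ?thesis
    using PairP computes.pair by (cases y rule: pair_exhaust) auto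
next
  case (CompP q r)
  then obtain u where "computes r x u" "computes q u y"
    using derivable D_sound by (auto simp: derivable_prog_code_iffs)
  then show ?thesis using CompP computes.comp by blast
next
  case (RecP q r)
  obtain w k where x_pair: "x = pair w k" by (rule pair_exhaust)
  show ?thesis
  proof (cases k)
    case 0
    then show ?thesis
      using RecP x_pair derivable D_sound computes.rec_0 by (simp add: derivable_prog_code_iffs)
  next
    case (Suc j)
    then obtain u where "computes p (pair w j) u" "computes r (triple w j u) y"
      using RecP x_pair derivable D_sound by (auto simp: derivable_prog_code_iffs)
    then show ?thesis using RecP x_pair Suc computes.rec_Suc by blast
  qed
next
  case (MuP q)
  then have "computes q (pair x y) 0" "\<forall>m<y. \<exists>v. computes q (pair x m) (Suc v)"
    using derivable D_sound by (auto simp: derivable_prog_code_iffs) blast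
  then show ?thesis using MuP computes.mu by blast
qed (use derivable in \<open>auto simp: derivable_prog_code_iffs
  intro: computes.zero computes.succ computes_FstP computes_SndP\<close>)

lemma computable_pred_derivable [computable_intros]:
  assumes "computable_fun n" "computable_fun M"
    "computable_fun a" "computable_fun x" "computable_fun y"
  shows "computable_pred (\<lambda>z. derivable (n z) (set_decode (M z)) (a z) (x z) (y z))"
  unfolding derivable_def
  by (intro assms assms[THEN computable_fun_comp, of pfst]
      assms[THEN computable_fun_comp, of "\<lambda>z. pfst (pfst z)"] computable_intros)

primrec stage :: "nat \<Rightarrow> nat set" where
  "stage 0 = {}"
| "stage (Suc n) = {t. t < n \<and> derivable n (stage n) (pfst t) (pfst (psnd t)) (psnd (psnd t))}"

lemma computable_pred_stage [computable_intros]: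
  assumes "computable_fun t" "computable_fun n"
  shows "computable_pred (\<lambda>x. t x \<in> stage (n x))"
proof -
  have stage_rec: "stage n = set_decode (rec_nat 0 (\<lambda>n M. set_encode {t. t < n \<and>
      derivable n (set_decode M) (pfst t) (pfst (psnd t)) (psnd (psnd t))}) n)" for n
    by (induction n) simp_all
  show ?thesis
    unfolding stage_rec by (intro computable_intros assms)
qed

lemma stage_sound: "triple (prog_code p) x y \<in> stage n \<Longrightarrow> computes p x y"
proof (induction n arbitrary: p x y)
  case (Suc n)
  have "derivable n (stage n) (prog_code p) x y" using Suc.prems by simp
  with Suc.IH show ?case by (rule derivable_sound)
qed simp

lemma eventually_ball_ex_lessI:
  fixes P :: "nat \<Rightarrow> nat \<Rightarrow> nat \<Rightarrow> bool"
  assumes "\<And>m. m < k \<Longrightarrow> \<exists>v. \<forall>\<^sub>F n in sequentially. P m v n"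
  shows "\<forall>\<^sub>F n in sequentially. \<forall>m<k. \<exists>v<n. P m v n"
proof -
  have "\<forall>\<^sub>F n in sequentially. \<exists>v<n. P m v n" if "m < k" for m
  proof -
    obtain v where "\<forall>\<^sub>F n in sequentially. P m v n"
      using assms \<open>m < k\<close> by blast
    then show ?thesis
      using eventually_gt_at_top[of v] by eventually_elim blast
  qed
  then have "\<forall>\<^sub>F n in sequentially. \<forall>m\<in>{..<k}. \<exists>v<n. P m v n"
    by (intro eventually_ball_finite) auto
  then show ?thesis by eventually_elim simp
qed

lemma eventually_mem_stageI:
  assumes "\<forall>\<^sub>F n in sequentially. derivable n (stage n) a x y"
  shows "\<forall>\<^sub>F n in sequentially. triple a x y \<in> stage n"
proof -
  have "\<forall>\<^sub>F n in sequentially. triple a x y \<in> stage (Suc n)"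
    using assms eventually_gt_at_top[of "triple a x y"] by eventually_elim simp
  then show ?thesis
    using eventually_sequentially_Suc[of "\<lambda>n. triple a x y \<in> stage n"] by blast
qed

lemma stage_complete:
  "computes p x y \<Longrightarrow> \<forall>\<^sub>F n in sequentially. triple (prog_code p) x y \<in> stage n"
proof (induction rule: computes.induct)
  case (pair p x u q v)
  show ?case
    by (rule eventually_mem_stageI, use pair.IH in eventually_elim)
      (simp add: derivable_prog_code_iffs)
next
  case (comp q x u p v)
  show ?case
    by (rule eventually_mem_stageI, use comp.IH eventually_gt_at_top[of u] in eventually_elim)
      (auto simp: derivable_prog_code_iffs)
next
  case (rec_0 p x u q)
  show ?case
    by (rule eventually_mem_stageI, use rec_0.IH in eventually_elim)
      (simp add: derivable_prog_code_iffs)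
next
  case (rec_Suc p q x n u v)
  show ?case
    by (rule eventually_mem_stageI, use rec_Suc.IH eventually_gt_at_top[of u] in eventually_elim)
      (auto simp: derivable_prog_code_iffs)
next
  case (mu p x k)
  have positive_below_k: "\<forall>\<^sub>F n in sequentially. \<forall>m<k. \<exists>v<n.
      triple (prog_code p) (pair x m) (Suc v) \<in> stage n"
    by (rule eventually_ball_ex_lessI) (use mu.IH(2) in blast)
  show ?case
    by (rule eventually_mem_stageI, use mu.IH(1) positive_below_k in eventually_elim)
      (simp add: derivable_prog_code_iffs)
qed (rule eventually_mem_stageI; simp add: derivable_prog_code_iffs)+

definition halts_within :: "nat \<Rightarrow> nat \<Rightarrow> nat \<Rightarrow> bool" where
  "halts_within s a x \<longleftrightarrow> (\<exists>t<s. triple a x (pfst t) \<in> stage (psnd t))"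

definition halts :: "nat \<Rightarrow> nat \<Rightarrow> bool" where
  "halts a x \<longleftrightarrow> (\<exists>s. halts_within s a x)"

lemma computable_pred_halts_within [computable_intros]:
  assumes "computable_fun s" "computable_fun a" "computable_fun x"
  shows "computable_pred (\<lambda>z. halts_within (s z) (a z) (x z))"
  unfolding halts_within_def
  by (intro assms assms[THEN computable_fun_comp, of pfst] computable_intros)

lemma eventually_halts_within_iff: "\<forall>\<^sub>F s in sequentially. halts_within s a x \<longleftrightarrow> halts a x"
proof (cases "halts a x")
  case True
  then obtain r where "halts_within r a x" unfolding halts_def by blast
  then have "halts_within s a x" if "r \<le> s" for s
    using that unfolding halts_within_def by (meson less_le_trans)
  with True show ?thesis unfolding eventually_sequentially by blast
qed (simp add: halts_def)

lemma halts_prog_code_iff: "halts (prog_code p) x \<longleftrightarrow> (\<exists>y. computes p x y)"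
proof
  assume "halts (prog_code p) x"
  then show "\<exists>y. computes p x y"
    unfolding halts_def halts_within_def using stage_sound by blast
next
  assume "\<exists>y. computes p x y"
  then obtain y n where "triple (prog_code p) x y \<in> stage n"
    using eventually_happens'[OF _ stage_complete] by fastforce
  then have "halts_within (Suc (pair y n)) (prog_code p) x"
    unfolding halts_within_def by (intro exI[of _ "pair y n"]) simp
  then show "halts (prog_code p) x" unfolding halts_def by blast
qed

lemma semidecidable_iff_halts: "semidecidable P \<longleftrightarrow> (\<exists>p. \<forall>x. P x \<longleftrightarrow> halts (prog_code p) x)"
  unfolding semidecidable_def halts_prog_code_iff by (rule refl)

section \<open>Computable rationals\<close>

definition computable_rat :: "(nat \<Rightarrow> rat) \<Rightarrow> bool" where
  "computable_rat f \<longleftrightarrow> (\<exists>c. computable_fun c \<and> (\<forall>x. nat_to_rat_surj (c x) = f x))"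

lemma computable_rat_nat_to_rat_surj:
  assumes "computable_fun c"
  shows "computable_rat (\<lambda>x. nat_to_rat_surj (c x))"
  using assms unfolding computable_rat_def by blast

lemma computable_rat_comp:
  assumes "computable_rat f" "computable_fun g"
  shows "computable_rat (\<lambda>x. f (g x))"
proof -
  obtain c where "computable_fun c" "\<And>x. nat_to_rat_surj (c x) = f x"
    using assms(1) unfolding computable_rat_def by blast
  with computable_fun_comp[OF _ assms(2)] show ?thesis
    unfolding computable_rat_def by (intro exI[of _ "\<lambda>x. c (g x)"]) simp
qed

lemma int_decode_eq_parity:
  "int_decode n = (if odd n then - int (Suc n div 2) else int (Suc n div 2))"
  by (auto simp: int_decode_def sum_decode_def elim!: evenE oddE)

lemma nat_to_rat_surj_eq_parity:
  "nat_to_rat_surj c = (if odd (pfst c) \<longleftrightarrow> odd (psnd c) then 1 else -1) *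
     (of_nat (Suc (pfst c) div 2) / of_nat (Suc (psnd c) div 2))"
proof -
  have "Fract (if s then - int a else int a) (if t then - int b else int b) =
      (if s \<longleftrightarrow> t then 1 else -1) * (of_nat a / of_nat b)" for s t a b
    by (simp add: Fract_of_int_quotient)
  then show ?thesis
    unfolding nat_to_rat_surj_def int_decode_eq_parity by (simp only: case_prod_beta Let_def)
qed

lemma nat_to_rat_surj_of_nat_quotient:
  "nat_to_rat_surj (pair (2 * a) (2 * b)) = of_nat a / of_nat b"
  by (simp add: nat_to_rat_surj_eq_parity)

lemma computable_rat_of_nat_quotient:
  assumes "computable_fun a" "computable_fun b"
  shows "computable_rat (\<lambda>x. of_nat (a x) / of_nat (b x))"
  unfolding nat_to_rat_surj_of_nat_quotient[symmetric]
  by (intro computable_rat_nat_to_rat_surj computable_intros assms)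

lemma computable_ratE:
  assumes "computable_rat f"
  obtains a b d where "computable_fun a" "computable_fun b" "computable_fun d"
    "\<And>x. 0 < d x" "\<And>x. f x = (of_nat (a x) - of_nat (b x)) / of_nat (d x)"
proof -
  obtain c where codes: "computable_fun c" "\<And>x. nat_to_rat_surj (c x) = f x"
    using assms unfolding computable_rat_def by blast
  define same_sign where "same_sign x \<longleftrightarrow> (odd (pfst (c x)) \<longleftrightarrow> odd (psnd (c x)))" for x
  \<comment> \<open>A code with denominator 0 represents 0.\<close>
  define num where "num x = (if psnd (c x) = 0 then 0 else Suc (pfst (c x)) div 2)" for x
  define den where "den x = (if psnd (c x) = 0 then 1 else Suc (psnd (c x)) div 2)" for x
  have "f x = (of_nat (if same_sign x then num x else 0) -
      of_nat (if same_sign x then 0 else num x)) / of_nat (den x)" for x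
    unfolding codes(2)[symmetric] nat_to_rat_surj_eq_parity same_sign_def num_def den_def
    by (simp del: odd_Suc_div_two even_Suc_div_two)
  moreover have "0 < den x" for x
    unfolding den_def by (auto simp: Suc_le_eq div_greater_zero_iff)
  moreover have "computable_pred same_sign" "computable_fun num" "computable_fun den"
    unfolding same_sign_def num_def den_def by (intro computable_intros codes(1))+
  ultimately show ?thesis
    by (intro that[of "\<lambda>x. if same_sign x then num x else 0"
          "\<lambda>x. if same_sign x then 0 else num x" den] computable_intros)
qed

lemma computable_pred_rat_less:
  assumes "computable_rat f" "computable_rat g"
  shows "computable_pred (\<lambda>x. f x < g x)"
proof -
  obtain a b d where f_quotient: "computable_fun a" "computable_fun b" "computable_fun d"
      "\<And>x. 0 < d x" "\<And>x. f x = (of_nat (a x) - of_nat (b x)) / of_nat (d x)"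
    using computable_ratE[OF assms(1)] by blast
  obtain a' b' d' where g_quotient: "computable_fun a'" "computable_fun b'" "computable_fun d'"
      "\<And>x. 0 < d' x" "\<And>x. g x = (of_nat (a' x) - of_nat (b' x)) / of_nat (d' x)"
    using computable_ratE[OF assms(2)] by blast
  have "f x < g x \<longleftrightarrow> a x * d' x + b' x * d x < a' x * d x + b x * d' x" for x
  proof -
    have "f x < g x \<longleftrightarrow> of_nat (a x * d' x + b' x * d x) < (of_nat (a' x * d x + b x * d' x) :: rat)"
      using f_quotient(4)[of x] g_quotient(4)[of x] unfolding f_quotient(5) g_quotient(5)
      by (simp add: field_simps)
    then show ?thesis by (simp only: of_nat_less_iff)
  qed
  then show ?thesis by (simp, intro computable_intros f_quotient g_quotient)
qed

section \<open>Cuts of limits of monotone sequences\<close>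

abbreviation coded_real :: "nat \<Rightarrow> real" where
  "coded_real c \<equiv> real_of_rat (nat_to_rat_surj c)"

lemma incseq_less_limit_iff:
  fixes a L :: "'a :: linorder_topology"
  assumes "incseq X" "X \<longlonglongrightarrow> L"
  shows "a < L \<longleftrightarrow> (\<exists>n. a < X n)"
proof
  assume "a < L"
  with assms(2) have "\<forall>\<^sub>F n in sequentially. a < X n" by (rule order_tendstoD)
  then show "\<exists>n. a < X n" unfolding eventually_sequentially by blast
qed (use incseq_le[OF assms] less_le_trans in blast)

lemma decseq_limit_less_iff:
  fixes a L :: "'a :: linorder_topology"
  assumes "decseq X" "X \<longlonglongrightarrow> L"
  shows "L < a \<longleftrightarrow> (\<exists>n. X n < a)"
proof
  assume "L < a"
  with assms(2) have "\<forall>\<^sub>F n in sequentially. X n < a" by (rule order_tendstoD)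
  then show "\<exists>n. X n < a" unfolding eventually_sequentially by blast
qed (use decseq_ge[OF assms] le_less_trans in blast)

lemma semidecidable_left_cut_if_incseq:
  assumes "computable_rat g" "incseq g" "(\<lambda>n. real_of_rat (g n)) \<longlonglongrightarrow> \<alpha>"
  shows "semidecidable (\<lambda>c. coded_real c < \<alpha>)"
proof -
  have "incseq (\<lambda>n. real_of_rat (g n))"
    using assms(2) by (simp add: incseq_def of_rat_less_eq)
  from incseq_less_limit_iff[OF this assms(3)]
  have "coded_real c < \<alpha> \<longleftrightarrow> (\<exists>n. nat_to_rat_surj c < g n)" for c
    by (simp add: of_rat_less)
  moreover have "computable_pred (\<lambda>z. nat_to_rat_surj (pfst z) < g (psnd z))"
    by (intro computable_pred_rat_less computable_rat_nat_to_rat_surj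
        computable_rat_comp[OF assms(1)] computable_intros)
  ultimately show ?thesis by (simp add: semidecidable_ex)
qed

lemma semidecidable_right_cut_if_decseq:
  assumes "computable_rat g" "decseq g" "(\<lambda>n. real_of_rat (g n)) \<longlonglongrightarrow> \<alpha>"
  shows "semidecidable (\<lambda>c. \<alpha> < coded_real c)"
proof -
  have "decseq (\<lambda>n. real_of_rat (g n))"
    using assms(2) by (simp add: decseq_def of_rat_less_eq)
  from decseq_limit_less_iff[OF this assms(3)]
  have "\<alpha> < coded_real c \<longleftrightarrow> (\<exists>n. g n < nat_to_rat_surj c)" for c
    by (simp add: of_rat_less)
  moreover have "computable_pred (\<lambda>z. g (psnd z) < nat_to_rat_surj (pfst z))"
    by (intro computable_pred_rat_less computable_rat_nat_to_rat_surj
        computable_rat_comp[OF assms(1)] computable_intros)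
  ultimately show ?thesis by (simp add: semidecidable_ex)
qed

section \<open>Base 4 expansions with digits 0 and 3\<close>

text \<open>\<open>Q e N\<close> decides the digit at position \<open>e\<close>, where \<open>N\<close> is formed by the earlier digits.\<close>

primrec expansion :: "(nat \<Rightarrow> nat \<Rightarrow> bool) \<Rightarrow> nat \<Rightarrow> nat" where
  "expansion Q 0 = 0"
| "expansion Q (Suc e) = 4 * expansion Q e + (if Q e (expansion Q e) then 3 else 0)"

abbreviation lower_end :: "(nat \<Rightarrow> nat \<Rightarrow> bool) \<Rightarrow> nat \<Rightarrow> real" where
  "lower_end Q e \<equiv> real (expansion Q e) / 4 ^ e"

abbreviation upper_end :: "(nat \<Rightarrow> nat \<Rightarrow> bool) \<Rightarrow> nat \<Rightarrow> real" where
  "upper_end Q e \<equiv> (real (expansion Q e) + 1) / 4 ^ e"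

definition expansion_real :: "(nat \<Rightarrow> nat \<Rightarrow> bool) \<Rightarrow> real" where
  "expansion_real Q = (SUP e. lower_end Q e)"

lemma computable_fun_expansion:
  assumes "computable_pred (\<lambda>z. Q (pfst z) (pfst (psnd z)) (psnd (psnd z)))" "computable_fun n"
  shows "computable_fun (\<lambda>x. expansion (Q x) (n x))"
proof -
  have expansion_rec:
    "expansion (Q x) e = rec_nat 0 (\<lambda>e N. 4 * N + (if Q x e N then 3 else 0)) e" for x e
    by (induction e) simp_all
  show ?thesis
    unfolding expansion_rec by (intro computable_intros assms)
qed

lemma lower_end_mono:
  assumes "e \<le> s"
  shows "lower_end Q e \<le> lower_end Q s"
  by (rule lift_Suc_mono_le[OF _ assms]) (simp add: field_simps)

lemma upper_end_antimono:
  assumes "e \<le> s"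
  shows "upper_end Q s \<le> upper_end Q e"
  by (rule lift_Suc_antimono_le[OF _ assms]) (simp add: field_simps)

lemma lower_end_less_upper_end: "lower_end Q s < upper_end Q e"
proof -
  have "lower_end Q s \<le> lower_end Q (max e s)"
    by (intro lower_end_mono) simp
  also have "\<dots> < upper_end Q (max e s)"
    by (intro divide_strict_right_mono) simp_all
  also have "\<dots> \<le> upper_end Q e"
    by (intro upper_end_antimono) simp
  finally show ?thesis .
qed

lemma expansion_real_ge_lower_end: "lower_end Q e \<le> expansion_real Q"
  unfolding expansion_real_def
proof (rule cSUP_upper)
  show "bdd_above (range (\<lambda>e. lower_end Q e))"
    using lower_end_less_upper_end[of Q _ 0] by (intro bdd_aboveI2[where M = 1] less_imp_le) simp
qed simp

lemma expansion_real_le_upper_end: "expansion_real Q \<le> upper_end Q e"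
  unfolding expansion_real_def
  by (intro cSUP_least less_imp_le lower_end_less_upper_end) simp

text \<open>Codes the midpoint of the interval from \<open>N / 4 ^ e\<close> to \<open>(N + 1) / 4 ^ e\<close>.\<close>

definition midpoint_code :: "nat \<Rightarrow> nat \<Rightarrow> nat" where
  "midpoint_code e N = pair (2 * (4 * N + 2)) (2 * 4 ^ Suc e)"

lemma coded_real_midpoint_code: "coded_real (midpoint_code e N) = (4 * real N + 2) / 4 ^ Suc e"
  unfolding midpoint_code_def nat_to_rat_surj_of_nat_quotient
  by (simp add: of_rat_divide of_rat_add of_rat_mult of_rat_power)

lemma midpoint_less_expansion_real:
  assumes "Q e (expansion Q e)"
  shows "coded_real (midpoint_code e (expansion Q e)) < expansion_real Q"
proof -
  have "coded_real (midpoint_code e (expansion Q e)) < lower_end Q (Suc e)"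
    unfolding coded_real_midpoint_code by (rule divide_strict_right_mono) (simp_all add: assms)
  also have "\<dots> \<le> expansion_real Q" by (rule expansion_real_ge_lower_end)
  finally show ?thesis .
qed

lemma expansion_real_less_midpoint:
  assumes "\<not> Q e (expansion Q e)"
  shows "expansion_real Q < coded_real (midpoint_code e (expansion Q e))"
proof -
  have "expansion_real Q \<le> upper_end Q (Suc e)"
    by (rule expansion_real_le_upper_end)
  also have "\<dots> < coded_real (midpoint_code e (expansion Q e))"
    unfolding coded_real_midpoint_code by (rule divide_strict_right_mono) (simp_all add: assms)
  finally show ?thesis .
qed

lemma midpoint_less_expansion_real_iff:
  "coded_real (midpoint_code e (expansion Q e)) < expansion_real Q \<longleftrightarrow> Q e (expansion Q e)"
  using midpoint_less_expansion_real[of Q e] expansion_real_less_midpoint[of Q e] less_asym by blast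

lemma expansion_real_less_midpoint_iff:
  "expansion_real Q < coded_real (midpoint_code e (expansion Q e)) \<longleftrightarrow> \<not> Q e (expansion Q e)"
  using midpoint_less_expansion_real[of Q e] expansion_real_less_midpoint[of Q e] less_asym by blast

lemma eventually_expansion_eq:
  assumes "\<And>e N. \<forall>\<^sub>F s in F. P s e N \<longleftrightarrow> Q e N"
  shows "\<forall>\<^sub>F s in F. expansion (P s) e = expansion Q e"
proof (induction e)
  case (Suc e)
  from Suc assms[of e "expansion Q e"] show ?case by eventually_elim simp
qed simp

lemma lower_end_tendsto_expansion_real:
  assumes "\<And>e N. \<forall>\<^sub>F s in sequentially. P s e N \<longleftrightarrow> Q e N"
  shows "(\<lambda>s. lower_end (P s) s) \<longlonglongrightarrow> expansion_real Q"
proof (rule tendstoI)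
  fix \<epsilon> :: real assume "0 < \<epsilon>"
  then obtain e where cell_less: "(1 / 4) ^ e < \<epsilon>"
    using real_arch_pow_inv[of \<epsilon> "1 / 4"] by auto
  have "\<forall>\<^sub>F s in sequentially. expansion (P s) e = expansion Q e"
    by (intro eventually_expansion_eq assms)
  then show "\<forall>\<^sub>F s in sequentially. dist (lower_end (P s) s) (expansion_real Q) < \<epsilon>"
    using eventually_ge_at_top[of e]
  proof eventually_elim
    case (elim s)
    have "lower_end Q e \<le> lower_end (P s) s" "lower_end (P s) s < upper_end Q e"
      using lower_end_mono[OF elim(2), of "P s"] lower_end_less_upper_end[of "P s" s e] elim(1)
      by simp_all
    then have "dist (lower_end (P s) s) (expansion_real Q) \<le> upper_end Q e - lower_end Q e"
      using expansion_real_ge_lower_end[of Q e] expansion_real_le_upper_end[of Q e]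
      unfolding dist_real_def by linarith
    also have "\<dots> = (1 / 4) ^ e" by (simp add: add_divide_distrib power_divide)
    finally show ?case using cell_less by simp
  qed
qed

section \<open>The diagonal real\<close>

text \<open>
  Position \<open>e\<close> diagonalizes against the program with code \<open>psnd e\<close>: as a semidecision procedure for
  the left cut if \<open>pfst e = 0\<close>, and for the right cut otherwise.
\<close>

definition diagonal_digit :: "nat \<Rightarrow> nat \<Rightarrow> bool" where
  "diagonal_digit e N \<longleftrightarrow> (pfst e = 0 \<longleftrightarrow> \<not> halts (psnd e) (midpoint_code e N))"

definition diagonal_digit_at :: "nat \<Rightarrow> nat \<Rightarrow> nat \<Rightarrow> bool" where
  "diagonal_digit_at s e N \<longleftrightarrow> (pfst e = 0 \<longleftrightarrow> \<not> halts_within s (psnd e) (midpoint_code e N))"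

definition diagonal_real :: real where
  "diagonal_real = expansion_real diagonal_digit"

definition diagonal_approx :: "nat \<Rightarrow> rat" where
  "diagonal_approx s = of_nat (expansion (diagonal_digit_at s) s) / of_nat (4 ^ s)"

lemma computable_pred_diagonal_digit_at [computable_intros]:
  assumes "computable_fun s" "computable_fun e" "computable_fun N"
  shows "computable_pred (\<lambda>x. diagonal_digit_at (s x) (e x) (N x))"
  unfolding diagonal_digit_at_def midpoint_code_def by (intro computable_intros assms)

lemma computable_rat_diagonal_approx: "computable_rat diagonal_approx"
  unfolding diagonal_approx_def[abs_def]
  by (intro computable_rat_of_nat_quotient computable_fun_expansion computable_intros)

lemma diagonal_approx_nonneg: "0 \<le> diagonal_approx s"
  by (simp add: diagonal_approx_def)

lemma real_of_rat_diagonal_approx: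
  "real_of_rat (diagonal_approx s) = lower_end (diagonal_digit_at s) s"
  by (simp add: diagonal_approx_def of_rat_divide of_rat_power)

lemma diagonal_approx_le_1: "diagonal_approx s \<le> 1"
proof -
  have "real_of_rat (diagonal_approx s) < real_of_rat 1"
    using lower_end_less_upper_end[of "diagonal_digit_at s" s 0]
    by (simp add: real_of_rat_diagonal_approx)
  then show ?thesis unfolding of_rat_less by (rule less_imp_le)
qed

lemma diagonal_approx_tendsto: "(\<lambda>s. real_of_rat (diagonal_approx s)) \<longlonglongrightarrow> diagonal_real"
  unfolding real_of_rat_diagonal_approx diagonal_real_def
proof (rule lower_end_tendsto_expansion_real)
  fix e N
  show "\<forall>\<^sub>F s in sequentially. diagonal_digit_at s e N \<longleftrightarrow> diagonal_digit e N"
    using eventually_halts_within_iff[of "psnd e" "midpoint_code e N"]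
    by eventually_elim (simp add: diagonal_digit_at_def diagonal_digit_def)
qed

lemma semidecidable_diagonal_real_cutE:
  assumes "semidecidable P"
  obtains c where "coded_real c \<noteq> diagonal_real" "coded_real c < diagonal_real \<longleftrightarrow> (P c \<longleftrightarrow> b)"
proof -
  obtain p where P_iff_halts: "\<And>c. P c \<longleftrightarrow> halts (prog_code p) c"
    using assms unfolding semidecidable_iff_halts by blast
  define e where "e = pair (of_bool b) (prog_code p)"
  define N where "N = expansion diagonal_digit e"
  define c where "c = midpoint_code e N"
  have below_iff: "coded_real c < diagonal_real \<longleftrightarrow> diagonal_digit e N"
    unfolding diagonal_real_def c_def N_def by (rule midpoint_less_expansion_real_iff)
  have above_iff: "diagonal_real < coded_real c \<longleftrightarrow> \<not> diagonal_digit e N"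
    unfolding diagonal_real_def c_def N_def by (rule expansion_real_less_midpoint_iff)
  have digit_iff: "diagonal_digit e N \<longleftrightarrow> (P c \<longleftrightarrow> b)"
    by (cases b) (simp_all add: diagonal_digit_def P_iff_halts c_def e_def)
  show ?thesis
  proof (rule that)
    show "coded_real c \<noteq> diagonal_real"
      using below_iff above_iff by (metis less_irrefl)
    show "coded_real c < diagonal_real \<longleftrightarrow> (P c \<longleftrightarrow> b)"
      using below_iff digit_iff by (rule trans)
  qed
qed

lemma not_semidecidable_left_cut_diagonal_real:
  "\<not> semidecidable (\<lambda>c. coded_real c < diagonal_real)"
  using semidecidable_diagonal_real_cutE[where b = False] by blast

lemma not_semidecidable_right_cut_diagonal_real:
  "\<not> semidecidable (\<lambda>c. diagonal_real < coded_real c)"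
  using semidecidable_diagonal_real_cutE[where b = True] by (metis less_asym linorder_neqE)

lemma diagonal_real_not_monotone_limit:
  assumes "computable_rat g" "(\<lambda>n. real_of_rat (g n)) \<longlonglongrightarrow> diagonal_real"
  shows "\<not> incseq g" "\<not> decseq g"
  using assms semidecidable_left_cut_if_incseq semidecidable_right_cut_if_decseq
    not_semidecidable_left_cut_diagonal_real not_semidecidable_right_cut_diagonal_real by blast+

section \<open>Approximations and mind changes\<close>

lemma computable_unit_rat_iff:
  "computable_unit_rat f \<longleftrightarrow>
     (\<forall>x s. 0 \<le> f x s \<and> f x s \<le> 1) \<and> computable_rat (\<lambda>z. f (pfst z) (psnd z))"
proof -
  have "(\<exists>p. \<forall>x s. \<exists>c. computes p (pair x s) c \<and> nat_to_rat_surj c = f x s) \<longleftrightarrow>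
      (\<exists>p. \<forall>z. \<exists>c. computes p z c \<and> nat_to_rat_surj c = f (pfst z) (psnd z))"
    by (metis fst_conv prod.collapse prod_decode_inverse prod_encode_inverse snd_conv)
  also have "\<dots> \<longleftrightarrow> computable_rat (\<lambda>z. f (pfst z) (psnd z))"
    unfolding computable_rat_def computable_fun_def choice_iff by blast
  finally show ?thesis unfolding computable_unit_rat_def by (rule conj_cong[OF refl])
qed

lemma delta2_approximation_const:
  assumes "computable_rat h" "\<And>s. 0 \<le> h s" "\<And>s. h s \<le> 1" "(\<lambda>s. real_of_rat (h s)) \<longlonglongrightarrow> \<alpha>"
  shows "delta2_approximation (\<lambda>_. h) (\<lambda>_. \<alpha>)"
  unfolding delta2_approximation_def computable_unit_rat_iff
  by (intro conjI allI assms computable_rat_comp[OF assms(1)] computable_intros)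

lemma delta2_approximation_imp_delta2_fuzzy_set:
  assumes "delta2_approximation f A"
  shows "delta2_fuzzy_set A"
proof -
  have unit: "0 \<le> real_of_rat (f x s)" "real_of_rat (f x s) \<le> 1"
    and lim: "(\<lambda>s. real_of_rat (f x s)) \<longlonglongrightarrow> A x" for x s
    using assms unfolding delta2_approximation_def computable_unit_rat_def by simp_all
  have "fuzzy_set A"
    unfolding fuzzy_set_def using LIMSEQ_le_const[OF lim] LIMSEQ_le_const2[OF lim] unit by blast
  with assms show ?thesis unfolding delta2_fuzzy_set_def by blast
qed

lemma delta2_approximation_tail:
  assumes "delta2_approximation f A"
  shows "computable_rat (\<lambda>s. f x (s + k))" "(\<lambda>s. real_of_rat (f x (s + k))) \<longlonglongrightarrow> A x"
proof -
  have computable_f: "computable_rat (\<lambda>z. f (pfst z) (psnd z))"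
    using assms by (simp add: delta2_approximation_def computable_unit_rat_iff)
  have "computable_fun (\<lambda>s. pair x (s + k))"
    by (intro computable_intros)
  from computable_rat_comp[OF computable_f this] show "computable_rat (\<lambda>s. f x (s + k))"
    by simp
  show "(\<lambda>s. real_of_rat (f x (s + k))) \<longlonglongrightarrow> A x"
    using assms by (intro LIMSEQ_ignore_initial_segment) (simp add: delta2_approximation_def)
qed

lemma convergent_discrete_iff:
  fixes X :: "nat \<Rightarrow> 'a :: discrete_topology"
  shows "convergent X \<longleftrightarrow> (\<exists>l. \<forall>\<^sub>F n in sequentially. X n = l)"
  unfolding convergent_def tendsto_discrete by (rule refl)

lemma convergent_if_finite_changes:
  fixes X :: "nat \<Rightarrow> 'a :: topological_space"
  assumes "finite {n. X (Suc n) \<noteq> X n}"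
  shows "convergent X"
proof -
  obtain k where changes_before_k: "\<And>n. X (Suc n) \<noteq> X n \<Longrightarrow> n < k"
    using assms unfolding finite_nat_set_iff_bounded by blast
  have "X n = X k" if "k \<le> n" for n
    using that
  proof (induction n rule: dec_induct)
    case (step n)
    then show ?case using changes_before_k[of n] by auto
  qed simp
  then have "\<forall>\<^sub>F n in sequentially. X n = X k"
    unfolding eventually_sequentially by blast
  then show ?thesis by (intro convergentI tendsto_eventually)
qed

lemma sigma_mind_change_convergent_imp_monotone:
  assumes "convergent (sigma_mind_change f x)"
  obtains k where "incseq (\<lambda>s. f x (s + k))" | k where "decseq (\<lambda>s. f x (s + k))"
proof -
  obtain l k where settled: "\<And>s. k \<le> s \<Longrightarrow> sigma_mind_change f x s = l"
    using assms unfolding convergent_discrete_iff eventually_sequentially by blast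
  have at_l: "sigma_mind_change f x (s + k) = l" "sigma_mind_change f x (Suc (s + k)) = l" for s
    by (rule settled; simp)+
  show ?thesis
  proof (cases "l = 1")
    case True
    have "f x (s + k) \<le> f x (Suc (s + k))" for s
      using at_l[of s] True by (auto split: if_splits)
    then show ?thesis using that(1)[of k] by (simp add: incseq_Suc_iff)
  next
    case False
    then have "f x (Suc (s + k)) \<le> f x (s + k)" for s
      using at_l[of s] by (auto split: if_splits)
    then show ?thesis using that(2)[of k] by (simp add: decseq_Suc_iff)
  qed
qed

lemma fuzzy_n_ceE:
  assumes "fuzzy_n_ce n A"
  obtains f where "delta2_approximation f A" "\<And>x. convergent (sigma_mind_change f x)"
  using assms convergent_if_finite_changes
  unfolding fuzzy_n_ce_def delta2_approximation_def by blast

theorem proposition5: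
  shows "\<exists>A :: nat \<Rightarrow> real.
    delta2_fuzzy_set A \<and>
    (\<forall>f. delta2_approximation f A \<longrightarrow> \<not> convergent (\<lambda>s. sigma_mind_change f 0 s)) \<and>
    (\<forall>n\<ge>1. \<not> fuzzy_n_ce n A)"
proof -
  let ?A = "\<lambda>_ :: nat. diagonal_real"
  have "delta2_approximation (\<lambda>_. diagonal_approx) ?A"
    by (intro delta2_approximation_const computable_rat_diagonal_approx diagonal_approx_nonneg
        diagonal_approx_le_1 diagonal_approx_tendsto)
  then have delta2: "delta2_fuzzy_set ?A"
    by (rule delta2_approximation_imp_delta2_fuzzy_set)
  have not_convergent: "\<not> convergent (sigma_mind_change f 0)"
    if approximation: "delta2_approximation f ?A" for f
  proof
    assume "convergent (sigma_mind_change f 0)"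
    then show False
      using delta2_approximation_tail[OF approximation, of 0] diagonal_real_not_monotone_limit
      by (cases rule: sigma_mind_change_convergent_imp_monotone) blast+
  qed
  moreover have "\<not> fuzzy_n_ce n ?A" for n
    using not_convergent by (blast elim: fuzzy_n_ceE)
  ultimately show ?thesis using delta2 by blast
qed

end
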